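(* Let $m\geq 1$ and $n\geq 0$ be integers and let $x_1,\ldots,x_m$ be indeterminates. Then, as an identity of rational functions in $x_1,\ldots,x_m$, $$\sum_{0\le r_1,\ldots,r_m\leq n}\ \prod_{k=1}^{m}\binom{n-r_k}{r_{k+1}}\frac{(-x_k)^{r_k}}{(1+x_k)^{r_k+r_{k+1}}}=\frac{1-x_1^{n+1}\cdots x_m^{n+1}}{1-x_1\cdots x_m}\prod_{k=1}^{m}\frac{1}{(1+x_k)^n},$$ where the sum is over integers $r_1,\ldots,r_m$ and $r_{m+1}=r_1$.
   Context: For integers $a,b\ge 0$, $\binom{a}{b}$ is the usual binomial coefficient, equal to $0$ when $b>a$. *)

theory Defs
  imports
    Main
    "HOL-Library.FuncSet"
    "HOL-Library.Poly_Mapping"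
    "HOL-Computational_Algebra.Fraction_Field"
begin

text \<open>
  Monomials are finitely supported exponent functions \<open>nat \<Rightarrow>\<^sub>0 nat\<close>, so polynomials over a field
  \<open>'a\<close> are finitely supported coefficient functions on monomials. The variables are indexed by all
  of \<open>nat\<close>; the field of rational functions in the first \<open>m\<close> of them is a subfield of
  \<open>'a ratfun\<close>.
\<close>

type_synonym 'a ratfun = "((nat \<Rightarrow>\<^sub>0 nat) \<Rightarrow>\<^sub>0 'a) fract"

definition indet :: "nat \<Rightarrow> 'a::field ratfun"
  where "indet k = Fract (Poly_Mapping.single (Poly_Mapping.single k 1) 1) 1"

definition cyc_Suc :: "nat \<Rightarrow> nat \<Rightarrow> nat"
  where "cyc_Suc m k = (if k = m then 1 else Suc k)"

text \<open>The denominators \<open>1 + x\<^sub>k\<close> and \<open>1 - x\<^sub>1\<cdots>x\<^sub>m\<close> are nonzero, so the convention \<open>x / 0 = 0\<close> plays no role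
  in identities with these denominators.\<close>

lemma one_plus_indet_nonzero: "1 + indet k \<noteq> (0 :: 'a::field ratfun)"
proof -
  let ?p = "1 + Poly_Mapping.single (Poly_Mapping.single k 1) 1 :: (nat \<Rightarrow>\<^sub>0 nat) \<Rightarrow>\<^sub>0 'a"
  have "Poly_Mapping.single k (1::nat) \<noteq> 0"
    by (metis lookup_single_eq lookup_zero zero_neq_one)
  then have "Poly_Mapping.lookup ?p 0 = 1"
    by (simp add: lookup_add lookup_single)
  then have "?p \<noteq> 0" by (metis lookup_zero zero_neq_one)
  moreover have "1 + indet k = Fract ?p 1"
    by (simp add: indet_def One_fract_def)
  ultimately show ?thesis by (simp add: Zero_fract_def eq_fract)
qed

lemma prod_indet:
  assumes "finite A"
  shows "(\<Prod>k\<in>A. indet k) =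
    (Fract (Poly_Mapping.single (\<Sum>k\<in>A. Poly_Mapping.single k 1) 1) 1 :: 'a::field ratfun)"
  using assms
  by (induction A rule: finite_induct) (simp_all add: One_fract_def indet_def mult_single)

lemma one_minus_prod_indet_nonzero:
  assumes "m \<ge> 1"
  shows "1 - (\<Prod>k=1..m. indet k) \<noteq> (0 :: 'a::field ratfun)"
proof -
  let ?e = "\<Sum>k=1..m. Poly_Mapping.single k (1::nat)"
  let ?p = "1 - Poly_Mapping.single ?e 1 :: (nat \<Rightarrow>\<^sub>0 nat) \<Rightarrow>\<^sub>0 'a"
  have "Poly_Mapping.lookup ?e 1 = (\<Sum>k=1..m. if k = 1 then 1 else 0)"
    by (simp add: lookup_sum lookup_single when_def)
  also have "\<dots> = 1" using assms by simp
  finally have "?e \<noteq> 0" by (metis lookup_zero zero_neq_one)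
  then have "Poly_Mapping.lookup ?p 0 = 1"
    by (simp add: lookup_minus lookup_single)
  then have "?p \<noteq> 0" by (metis lookup_zero zero_neq_one)
  moreover have "1 - (\<Prod>k=1..m. indet k) = Fract ?p 1"
    by (simp add: prod_indet One_fract_def)
  ultimately show ?thesis by (simp add: Zero_fract_def eq_fract)
qed

end

theory Submission
  imports Defs "HOL-Computational_Algebra.Polynomial"
begin

text \<open>
  The sum is the trace of a product of \<open>m\<close> matrices of size \<open>n + 1\<close>. The \<open>k\<close>-th factor is the
  \<open>n\<close>-th symmetric power of the \<open>2 \<times> 2\<close> matrix with rows \<open>(1, 1/(1+x\<^sub>k))\<close> and
  \<open>(-x\<^sub>k/(1+x\<^sub>k), 0)\<close>. Conjugation by the matrix with rows \<open>(1, 1)\<close> and \<open>(0, 1)\<close>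
  makes all of these lower triangular simultaneously, with diagonal \<open>(1/(1+x\<^sub>k), x\<^sub>k/(1+x\<^sub>k))\<close>.
  So the trace is the complete homogeneous polynomial of degree \<open>n\<close> in the two eigenvalues
  \<open>\<Prod>k. 1/(1+x\<^sub>k)\<close> and \<open>\<Prod>k. x\<^sub>k/(1+x\<^sub>k)\<close>, a geometric sum.
\<close>

section \<open>Symmetric powers of 2 x 2 matrices\<close>

text \<open>For \<open>i\<close> \<le> \<open>n\<close>, row \<open>i\<close> of the symmetric power
  holds the coefficients of the image of u^(n-i) v^i under u -> a u + b v, v -> c u + d v,
  dehomogenized by u = 1.\<close>

definition sym_pow :: "nat \<Rightarrow> 'a::comm_ring_1 \<Rightarrow> 'a \<Rightarrow> 'a \<Rightarrow> 'a \<Rightarrow> nat \<Rightarrow> nat \<Rightarrow> 'a"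
  where "sym_pow n a b c d i j = coeff ([:a, b:] ^ (n - i) * [:c, d:] ^ i) j"

text \<open>This is v^n p(u/v) without division: the form of degree \<open>n\<close> attached to
  \<open>p\<close>, evaluated at \<open>u\<close> and \<open>v\<close>.\<close>

definition homogenize :: "nat \<Rightarrow> 'a::comm_ring_1 poly \<Rightarrow> 'a poly \<Rightarrow> 'a poly \<Rightarrow> 'a poly"
  where "homogenize n p u v = (\<Sum>r\<le>n. smult (coeff p r) (u ^ r * v ^ (n - r)))"

lemma homogenize_linear_mult:
  assumes "degree p \<le> n"
  shows "homogenize (Suc n) ([:a, b:] * p) u v = (smult a v + smult b u) * homogenize n p u v"
proof -
  have "(\<Sum>r\<le>Suc n. smult (a * coeff p r) (u ^ r * v ^ (Suc n - r)))
      = (\<Sum>r\<le>n. smult (a * coeff p r) (u ^ r * v ^ (Suc n - r)))"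
    \<comment> \<open>The degree bound kills the top term \<open>r = Suc n\<close>, so a factor
      \<open>v\<close> can be split off every remaining term.\<close>
    using assms by (simp add: coeff_eq_0)
  also have "\<dots> = smult a v * homogenize n p u v"
    unfolding homogenize_def sum_distrib_left
    by (intro sum.cong) (simp_all add: Suc_diff_le mult_ac)
  finally have const_part: "(\<Sum>r\<le>Suc n. smult (a * coeff p r) (u ^ r * v ^ (Suc n - r)))
      = smult a v * homogenize n p u v" .
  have "(\<Sum>r\<le>Suc n. smult (coeff (pCons 0 (smult b p)) r) (u ^ r * v ^ (Suc n - r)))
      = (\<Sum>r\<le>n. smult (b * coeff p r) (u ^ Suc r * v ^ (n - r)))"
    by (subst sum.atMost_Suc_shift) simp
  also have "\<dots> = smult b u * homogenize n p u v"
    unfolding homogenize_def sum_distrib_left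
    by (intro sum.cong) (simp_all add: mult_ac)
  finally have linear_part:
    "(\<Sum>r\<le>Suc n. smult (coeff (pCons 0 (smult b p)) r) (u ^ r * v ^ (Suc n - r)))
      = smult b u * homogenize n p u v" .
  have "homogenize (Suc n) ([:a, b:] * p) u v
      = (\<Sum>r\<le>Suc n. smult (a * coeff p r) (u ^ r * v ^ (Suc n - r)))
        + (\<Sum>r\<le>Suc n. smult (coeff (pCons 0 (smult b p)) r) (u ^ r * v ^ (Suc n - r)))"
    unfolding homogenize_def sum.distrib[symmetric]
    by (intro sum.cong) (simp_all add: smult_add_left)
  then show ?thesis
    by (simp only: const_part linear_part distrib_right)
qed

lemma degree_linear_mult_le:
  assumes "degree p \<le> n"
  shows "degree ([:a, b:] * p) \<le> Suc n"
  using assms degree_mult_le[of "[:a, b:]" p] degree_pCons_le[of a "[:b:]"] by simp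

lemma degree_linear_power_mult_le:
  assumes "degree p \<le> n"
  shows "degree ([:a, b:] ^ k * p) \<le> k + n"
proof (induction k)
  case 0
  then show ?case using assms by simp
next
  case (Suc k)
  then show ?case
    using degree_linear_mult_le[of "[:a, b:] ^ k * p" "k + n" a b]
    by (simp only: power_Suc mult.assoc add_Suc)
qed

lemma homogenize_linear_power_mult:
  assumes "degree p \<le> n"
  shows "homogenize (k + n) ([:a, b:] ^ k * p) u v
    = (smult a v + smult b u) ^ k * homogenize n p u v"
proof (induction k)
  case 0
  then show ?case by simp
next
  case (Suc k)
  have "homogenize (Suc (k + n)) ([:a, b:] * ([:a, b:] ^ k * p)) u v
      = (smult a v + smult b u) * homogenize (k + n) ([:a, b:] ^ k * p) u v"
    by (intro homogenize_linear_mult degree_linear_power_mult_le assms)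
  then show ?case
    by (simp only: Suc power_Suc mult.assoc add_Suc)
qed

lemma homogenize_linear_powers:
  assumes "i \<le> n"
  shows "homogenize n ([:a, b:] ^ (n - i) * [:c, d:] ^ i) u v
    = (smult a v + smult b u) ^ (n - i) * (smult c v + smult d u) ^ i"
proof -
  have hom: "homogenize i ([:c, d:] ^ i) u v = (smult c v + smult d u) ^ i"
    using homogenize_linear_power_mult[of 1 0 i c d u v] by (simp add: homogenize_def)
  have "degree ([:c, d:] ^ i) \<le> i"
    using degree_linear_power_mult_le[of 1 0 c d i] by simp
  from homogenize_linear_power_mult[OF this, of "n - i" a b u v] show ?thesis
    using assms by (simp only: hom) simp
qed

text \<open>Multiplying by the second matrix substitutes its rows for the two variables in the form
  given by row \<open>i\<close> of the first. Homogenization respects the linear factors, so this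
  composes the two linear substitutions.\<close>

lemma sym_pow_mult:
  assumes "i \<le> n"
  shows "(\<Sum>r=0..n. sym_pow n a b c d i r * sym_pow n a' b' c' d' r j)
    = sym_pow n (a * a' + b * c') (a * b' + b * d') (c * a' + d * c') (c * b' + d * d') i j"
proof -
  let ?p = "[:a, b:] ^ (n - i) * [:c, d:] ^ i"
  have "(\<Sum>r=0..n. sym_pow n a b c d i r * sym_pow n a' b' c' d' r j)
      = coeff (homogenize n ?p [:c', d':] [:a', b':]) j"
    unfolding homogenize_def coeff_sum atMost_atLeast0
    by (intro sum.cong) (simp_all add: sym_pow_def mult_ac)
  also have "homogenize n ?p [:c', d':] [:a', b':]
      = [:a * a' + b * c', a * b' + b * d':] ^ (n - i) * [:c * a' + d * c', c * b' + d * d':] ^ i"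
    using assms by (subst homogenize_linear_powers) simp_all
  finally show ?thesis by (simp add: sym_pow_def)
qed

lemma sym_pow_one: "sym_pow n 1 0 0 1 i j = (if i = j then 1 else 0)"
proof -
  have "[:0, 1:] ^ i = monom (1 :: 'a) i"
    by (simp add: monom_altdef)
  then show ?thesis
    by (simp add: sym_pow_def one_pCons[symmetric])
qed

text \<open>With upper right entry 0 the first factor is a constant, and coefficient
  \<open>i\<close> of the second is its leading term \<open>d ^ i\<close>.\<close>

lemma sym_pow_lower_triangular_diag: "sym_pow n a 0 c d i i = a ^ (n - i) * d ^ i"
proof -
  have "[:a, 0:] ^ (n - i) = [:a ^ (n - i):]"
    by (induction "n - i") (simp_all add: poly_const_pow)
  then show ?thesis
    by (simp add: sym_pow_def coeff_linear_poly_power)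
qed

text \<open>The matrix is L U with L = (a-c, -d; c, d) and U = (1, 1; 0, 1), while U L = (a, 0; c,
  d) is triangular. Swapping the factors under the trace avoids inverting U.\<close>

lemma trace_sym_pow_conjugate:
  "(\<Sum>i=0..n. sym_pow n (a - c) (a - c - d) c (c + d) i i) = (\<Sum>i=0..n. a ^ (n - i) * d ^ i)"
proof -
  have "(\<Sum>i=0..n. sym_pow n (a - c) (a - c - d) c (c + d) i i)
      = (\<Sum>i=0..n. \<Sum>r=0..n. sym_pow n (a - c) (-d) c d i r * sym_pow n 1 1 0 1 r i)"
    by (intro sum.cong refl) (simp add: sym_pow_mult)
  also have "\<dots> = (\<Sum>r=0..n. \<Sum>i=0..n. sym_pow n 1 1 0 1 r i * sym_pow n (a - c) (-d) c d i r)"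
    by (subst sum.swap) (simp add: mult.commute)
  also have "\<dots> = (\<Sum>r=0..n. sym_pow n a 0 c d r r)"
    by (intro sum.cong refl) (simp add: sym_pow_mult)
  finally show ?thesis by (simp add: sym_pow_lower_triangular_diag)
qed

section \<open>Sums over closed paths as traces\<close>

lemma sum_PiE_atLeastAtMost_Suc:
  fixes f :: "(nat \<Rightarrow> 'b) \<Rightarrow> 'a::comm_monoid_add"
  assumes "finite S"
  shows "(\<Sum>r \<in> {1..Suc m} \<rightarrow>\<^sub>E S. f r) = (\<Sum>r \<in> {1..m} \<rightarrow>\<^sub>E S. \<Sum>l\<in>S. f (r(Suc m := l)))"
proof -
  have "(\<Sum>r \<in> {1..Suc m} \<rightarrow>\<^sub>E S. f r)
      = (\<Sum>r \<in> (\<lambda>(y, g). g(Suc m := y)) ` (S \<times> ({1..m} \<rightarrow>\<^sub>E S)). f r)"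
    by (simp add: atLeastAtMostSuc_conv PiE_insert_eq)
  also have "\<dots> = (\<Sum>(l, r) \<in> S \<times> ({1..m} \<rightarrow>\<^sub>E S). f (r(Suc m := l)))"
    using inj_combinator[of "Suc m" "{1..m}" "\<lambda>_. S"]
    by (subst sum.reindex) (simp_all add: case_prod_unfold)
  also have "\<dots> = (\<Sum>l\<in>S. \<Sum>r \<in> {1..m} \<rightarrow>\<^sub>E S. f (r(Suc m := l)))"
    by (simp add: sum.cartesian_product)
  finally show ?thesis by (subst sum.swap) simp
qed

text \<open>
  \<open>C m\<close> is the matrix product \<open>A 1 \<cdots> A m\<close>. The weight \<open>g\<close> on the two ends of the path makes
  the induction go through, and later closes the path into a cycle.
\<close>

lemma sum_paths_eq_matrix_product:
  fixes A C :: "nat \<Rightarrow> 'b \<Rightarrow> 'b \<Rightarrow> 'a::comm_ring_1"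
  assumes S: "finite S"
    and C0: "\<And>i j. i \<in> S \<Longrightarrow> j \<in> S \<Longrightarrow> C 0 i j = (if i = j then 1 else 0)"
    and CSuc: "\<And>m i j. i \<in> S \<Longrightarrow> j \<in> S \<Longrightarrow> C (Suc m) i j = (\<Sum>l\<in>S. C m i l * A (Suc m) l j)"
  shows "(\<Sum>r \<in> {1..Suc m} \<rightarrow>\<^sub>E S. (\<Prod>k=1..m. A k (r k) (r (Suc k))) * g (r 1) (r (Suc m)))
    = (\<Sum>i\<in>S. \<Sum>j\<in>S. C m i j * g i j)"
proof (induction m arbitrary: g)
  case 0
  have "(\<Sum>i\<in>S. \<Sum>j\<in>S. C 0 i j * g i j) = (\<Sum>i\<in>S. \<Sum>j\<in>S. if i = j then g i j else 0)"
    by (intro sum.cong refl) (simp add: C0)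
  also have "\<dots> = (\<Sum>i\<in>S. g i i)"
    using S by (intro sum.cong refl) simp
  finally show ?case
    using S by (subst sum_PiE_atLeastAtMost_Suc) simp_all
next
  case (Suc m)
  \<comment> \<open>Summing out the last vertex absorbs the last edge into the weight.\<close>
  let ?g = "\<lambda>i j. \<Sum>l\<in>S. A (Suc m) j l * g i l"
  have "(\<Sum>r \<in> {1..Suc (Suc m)} \<rightarrow>\<^sub>E S.
        (\<Prod>k=1..Suc m. A k (r k) (r (Suc k))) * g (r 1) (r (Suc (Suc m))))
      = (\<Sum>r \<in> {1..Suc m} \<rightarrow>\<^sub>E S. (\<Prod>k=1..m. A k (r k) (r (Suc k))) * ?g (r 1) (r (Suc m)))"
    using S by (subst sum_PiE_atLeastAtMost_Suc) (simp_all add: sum_distrib_left mult.assoc)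
  also have "\<dots> = (\<Sum>i\<in>S. \<Sum>j\<in>S. C m i j * ?g i j)"
    by (rule Suc.IH)
  also have "\<dots> = (\<Sum>i\<in>S. \<Sum>j\<in>S. C (Suc m) i j * g i j)"
  proof (rule sum.cong[OF refl])
    fix i assume "i \<in> S"
    have "(\<Sum>j\<in>S. C m i j * ?g i j) = (\<Sum>l\<in>S. \<Sum>j\<in>S. C m i j * (A (Suc m) j l * g i l))"
      unfolding sum_distrib_left by (rule sum.swap)
    also have "\<dots> = (\<Sum>l\<in>S. C (Suc m) i l * g i l)"
      using \<open>i \<in> S\<close> by (intro sum.cong refl) (simp add: CSuc sum_distrib_right mult.assoc)
    finally show "(\<Sum>j\<in>S. C m i j * ?g i j) = (\<Sum>j\<in>S. C (Suc m) i j * g i j)" .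
  qed
  finally show ?case .
qed

lemma sum_cycles_eq_trace:
  fixes A C :: "nat \<Rightarrow> 'b \<Rightarrow> 'b \<Rightarrow> 'a::comm_ring_1"
  assumes S: "finite S" and "m \<ge> 1"
    and C0: "\<And>i j. i \<in> S \<Longrightarrow> j \<in> S \<Longrightarrow> C 0 i j = (if i = j then 1 else 0)"
    and CSuc: "\<And>m i j. i \<in> S \<Longrightarrow> j \<in> S \<Longrightarrow> C (Suc m) i j = (\<Sum>l\<in>S. C m i l * A (Suc m) l j)"
  shows "(\<Sum>r \<in> {1..m} \<rightarrow>\<^sub>E S. \<Prod>k=1..m. A k (r k) (r (cyc_Suc m k))) = (\<Sum>i\<in>S. C m i i)"
proof -
  obtain m' where m: "m = Suc m'" using \<open>m \<ge> 1\<close> by (cases m) auto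
  have "(\<Prod>k=1..m. A k (r k) (r (cyc_Suc m k)))
      = (\<Prod>k=1..m'. A k (r k) (r (Suc k))) * A m (r m) (r 1)" for r
    by (simp add: m cyc_Suc_def)
  \<comment> \<open>The \<open>m\<close> vertices are joined by \<open>m - 1\<close> path edges; the
    edge from \<open>r m\<close> back to \<open>r 1\<close> serves as the weight.\<close>
  then have "(\<Sum>r \<in> {1..m} \<rightarrow>\<^sub>E S. \<Prod>k=1..m. A k (r k) (r (cyc_Suc m k)))
      = (\<Sum>i\<in>S. \<Sum>j\<in>S. C m' i j * A m j i)"
    using sum_paths_eq_matrix_product[where g = "\<lambda>i j. A m j i" and A = A and C = C and m = m'
        and S = S] assms by (simp add: m)
  then show ?thesis by (simp add: m CSuc)
qed

section \<open>The cyclic binomial sum\<close>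

text \<open>The lower left entry of the product of the triangularised \<open>2 \<times> 2\<close> matrices.\<close>

primrec lower_left :: "(nat \<Rightarrow> 'a::field) \<Rightarrow> nat \<Rightarrow> 'a" where
  "lower_left x 0 = 0"
| "lower_left x (Suc m) = lower_left x m * (1 / (1 + x (Suc m)))
     + (\<Prod>k=1..m. x k / (1 + x k)) * (- x (Suc m) / (1 + x (Suc m)))"

lemma sym_pow_factor:
  fixes x :: "'a::field"
  shows "sym_pow n 1 (1 / (1 + x)) (- x / (1 + x)) 0 i j
    = of_nat ((n - i) choose j) * ((- x) ^ i / (1 + x) ^ (i + j))"
proof -
  have "[:- x / (1 + x), 0:] ^ i = [:(- x / (1 + x)) ^ i:]"
    by (simp add: poly_const_pow)
  then have "sym_pow n 1 (1 / (1 + x)) (- x / (1 + x)) 0 i j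
      = (- x / (1 + x)) ^ i * coeff ([:1, 1 / (1 + x):] ^ (n - i)) j"
    by (simp add: sym_pow_def)
  also have "coeff ([:1, 1 / (1 + x):] ^ (n - i)) j = of_nat ((n - i) choose j) * (1 / (1 + x)) ^ j"
  proof (cases "j \<le> n - i")
    case True
    then show ?thesis by (simp add: coeff_linear_poly_power)
  next
    case False
    moreover have "degree ([:1, 1 / (1 + x):] ^ (n - i)) \<le> n - i"
      using degree_linear_power_mult_le[of 1 0 1 "1 / (1 + x)" "n - i"] by simp
    ultimately show ?thesis by (simp add: coeff_eq_0 binomial_eq_0)
  qed
  finally show ?thesis
    by (simp only: power_divide power_add power_one) (simp add: mult_ac)
qed

text \<open>Rational functions matter only through nonzero denominators, so the identity is proved
  for elements of any field.\<close>

lemma cyclic_binomial_sum: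
  fixes x :: "nat \<Rightarrow> 'a::field"
  assumes "m \<ge> 1" and nz: "\<And>k. 1 + x k \<noteq> 0" and X: "1 - (\<Prod>k=1..m. x k) \<noteq> 0"
  shows "(\<Sum>r \<in> {1..m} \<rightarrow>\<^sub>E {0..n}. \<Prod>k=1..m.
            of_nat ((n - r k) choose r (cyc_Suc m k)) *
              ((- x k) ^ r k / (1 + x k) ^ (r k + r (cyc_Suc m k))))
       = (1 - (\<Prod>k=1..m. x k ^ (n + 1))) / (1 - (\<Prod>k=1..m. x k)) *
           (\<Prod>k=1..m. 1 / (1 + x k) ^ n)"
proof -
  define a where "a = (\<lambda>m. \<Prod>k=1..m. 1 / (1 + x k))"
  define d where "d = (\<lambda>m. \<Prod>k=1..m. x k / (1 + x k))"
  define c where "c = lower_left x"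
  define A where "A = (\<lambda>k. sym_pow n 1 (1 / (1 + x k)) (- x k / (1 + x k)) 0)"
  \<comment> \<open>This is the symmetric power of U^(-1) T U with T = (a m, 0; c m, d m) and U =
    (1, 1; 0, 1), the shape required by \<open>trace_sym_pow_conjugate\<close>.\<close>
  define C where "C = (\<lambda>m. sym_pow n (a m - c m) (a m - c m - d m) (c m) (c m + d m))"
  have C0: "C 0 i j = (if i = j then 1 else 0)" for i j
    by (simp add: C_def a_def d_def c_def sym_pow_one)
  have CSuc: "C (Suc m) i j = (\<Sum>l=0..n. C m i l * A (Suc m) l j)" if "i \<in> {0..n}" for m i j
  proof -
    \<comment> \<open>In terms of \<open>y\<close> all entries and recurrences are polynomial, so
      comparing the matrix products is ring arithmetic.\<close>
    define y where "y = 1 / (1 + x (Suc m))"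
    have y: "- x (Suc m) / (1 + x (Suc m)) = y - 1" "x (Suc m) / (1 + x (Suc m)) = 1 - y"
      using nz[of "Suc m"] by (simp_all add: y_def divide_simps)
    have rec: "a (Suc m) = a m * y" "d (Suc m) = d m * (1 - y)"
      "c (Suc m) = c m * y + d m * (y - 1)"
      by (simp_all only: a_def d_def c_def lower_left.simps prod.cl_ivl_Suc y y_def[symmetric]) simp_all
    have "(\<Sum>l=0..n. C m i l * A (Suc m) l j)
      = sym_pow n ((a m - c m) + (a m - c m - d m) * (y - 1)) ((a m - c m) * y)
          (c m + (c m + d m) * (y - 1)) (c m * y) i j"
      unfolding C_def A_def y y_def[symmetric] using that by (subst sym_pow_mult) simp_all
    then show ?thesis
      by (simp add: C_def rec algebra_simps)
  qed
  define X where "X = (\<Prod>k=1..m. x k)"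
  \<comment> \<open>The two eigenvalues share their denominators, which makes the trace a geometric
    sum with ratio \<open>X\<close>.\<close>
  have d_eq: "d m = X * a m"
    by (simp add: d_def a_def X_def prod_dividef)
  have "(\<Sum>r \<in> {1..m} \<rightarrow>\<^sub>E {0..n}. \<Prod>k=1..m. A k (r k) (r (cyc_Suc m k)))
      = (\<Sum>i=0..n. C m i i)"
    using \<open>m \<ge> 1\<close> by (intro sum_cycles_eq_trace C0 CSuc) simp_all
  also have "\<dots> = (\<Sum>i=0..n. a m ^ (n - i) * d m ^ i)"
    unfolding C_def by (rule trace_sym_pow_conjugate)
  also have "\<dots> = (\<Sum>i=0..n. a m ^ n * X ^ i)"
    by (intro sum.cong refl) (simp add: d_eq power_mult_distrib mult_ac flip: power_add)
  also have "\<dots> = a m ^ n * (\<Sum>i<Suc n. X ^ i)"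
    by (simp add: sum_distrib_left atLeast0AtMost lessThan_Suc_atMost)
  also have "\<dots> = (1 - X ^ Suc n) / (1 - X) * a m ^ n"
    using X one_diff_power_eq[of X "Suc n"] by (simp add: X_def)
  also have "X ^ Suc n = (\<Prod>k=1..m. x k ^ (n + 1))"
    by (simp only: X_def prod_power_distrib Suc_eq_plus1)
  also have "a m ^ n = (\<Prod>k=1..m. 1 / (1 + x k) ^ n)"
    by (simp only: a_def prod_power_distrib power_divide power_one)
  finally show ?thesis
    by (simp only: A_def sym_pow_factor X_def)
qed

theorem theorem3p1:
  fixes m n :: nat and x :: "nat \<Rightarrow> 'a::field ratfun"
  defines "x \<equiv> indet"
  assumes "m \<ge> 1"
  shows "(\<Sum>r \<in> {1..m} \<rightarrow>\<^sub>E {0..n}. \<Prod>k=1..m.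
            of_nat ((n - r k) choose r (cyc_Suc m k)) *
              ((- x k) ^ r k / (1 + x k) ^ (r k + r (cyc_Suc m k))))
       = (1 - (\<Prod>k=1..m. x k ^ (n + 1))) / (1 - (\<Prod>k=1..m. x k)) *
           (\<Prod>k=1..m. 1 / (1 + x k) ^ n)"
  unfolding x_def
  using assms by (intro cyclic_binomial_sum one_plus_indet_nonzero one_minus_prod_indet_nonzero)

end
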